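(* Suppose $f:\mathcal{X}\to\mathbb{R}$ is $\ell$-smooth where $\ell$ is sub-quadratic, and let $x_0\in\mathcal{X}$. Let $G:=\sup\left\{u\ge0\mid u^2\le2\ell(2u)\cdot(f(x_0)-f^* )\right\}$ and $L:=\ell(2G)$. If $0<\eta\le1/L$, the gradient descent iterates $x_{t+1}=x_t-\eta\nabla f(x_t)$ satisfy $\|\nabla f(x_t)\|\le G$ for all $t\ge0$, and for every integer $T\ge1$ $$\frac1T\sum_{t<T}\|\nabla f(x_t)\|^2\le\frac{2(f(x_0)-f^* )}{\eta T}.$$
   Context: $\mathcal{X}\subseteq\mathbb{R}^d$ is the domain of $f$; $\|\cdot\|$ is the Euclidean norm for vectors and the operator norm for matrices. Standing assumptions: (1) $\mathcal{X}$ is open, $f$ is differentiable on $\mathcal{X}$ and closed, i.e. for each $a\in\mathbb{R}$ the sub-level set $\{x\in\mathcal{X}: f(x)\le a\}$ is closed (in $\mathbb{R}^d$); (2) $f^*:=\inf_{x\in\mathcal{X}}f(x)>-\infty$. $\ell$-smoothness: for a non-decreasing continuous function $\ell:[0,+\infty)\to(0,+\infty)$, a differentiable $f:\mathcal{X}\to\mathbb{R}$ is $\ell$-smooth if $\|\nabla^2f(x)\|\le\ell(\|\nabla f(x)\|)$ almost everywhere (with respect to the Lebesgue measure) in $\mathcal{X}$. $\ell$ is sub-quadratic if $\lim_{u\to\infty}\ell(u)/u^2=0$. The assertion about the iterates includes that they remain in $\mathcal{X}$, so that the recursion is well defined. The sum is over $t=0,\dots,T-1$.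
   Formalization: ℓ-smoothness here also requires ∇f to be absolutely continuous along every segment in 𝒳; with only the a.e. Hessian bound the claim fails, e.g. for f on ℝ, even, with f′ a multiple of the Cantor function on [0,∞). *)

theory Defs
  imports "HOL-Analysis.Analysis"
begin

text \<open>Only meaningful where \<open>f\<close> is differentiable (there the gradient exists and is unique).\<close>
definition grad :: "('a::euclidean_space \<Rightarrow> real) \<Rightarrow> 'a \<Rightarrow> 'a" where
  "grad f x = (THE D. GDERIV f x :> D)"

text \<open>The usual \<open>\<epsilon>\<close>-\<open>\<delta>\<close> definition: \<open>D\<close> ranges over the finite families of non-overlapping
  compact subintervals of \<open>{a..b}\<close>.\<close>
definition abs_continuous_on_interval :: "real \<Rightarrow> real \<Rightarrow> (real \<Rightarrow> 'b::metric_space) \<Rightarrow> bool" where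
  "abs_continuous_on_interval a b g \<longleftrightarrow>
     (\<forall>\<epsilon>>0. \<exists>\<delta>>0. \<forall>D S. D division_of S \<and> S \<subseteq> {a..b} \<and> (\<Sum>K\<in>D. Sup K - Inf K) < \<delta> \<longrightarrow>
        (\<Sum>K\<in>D. dist (g (Sup K)) (g (Inf K))) < \<epsilon>)"

text \<open>A Hessian that exists only almost everywhere has to determine the gradient. If it is just the
  pointwise derivative of the gradient, then a function on \<open>\<real>\<close> whose derivative is the Cantor
  function has Hessian \<open>0\<close> almost everywhere, hence satisfies every almost-everywhere bound, and no
  smoothness can be inferred from such a bound. The first conjunct is the standard regularity that
  excludes this: the gradient is absolutely continuous along each segment in \<open>X\<close>. It is automatic
  when the gradient is locally Lipschitz, in particular when \<open>f\<close> is twice continuously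
  differentiable. In the second conjunct \<open>H\<close> is the Hessian at \<open>x\<close> as a linear map and \<open>onorm H\<close>
  its operator norm.\<close>
definition ell_smooth_on :: "'a::euclidean_space set \<Rightarrow> (real \<Rightarrow> real) \<Rightarrow> ('a \<Rightarrow> real) \<Rightarrow> bool" where
  "ell_smooth_on X \<l> f \<longleftrightarrow>
     (\<forall>x y. closed_segment x y \<subseteq> X \<longrightarrow> abs_continuous_on_interval 0 1 (grad f \<circ> linepath x y)) \<and>
     (AE x in lebesgue. x \<in> X \<longrightarrow>
        (\<exists>H. (grad f has_derivative H) (at x) \<and> onorm H \<le> \<l> (norm (grad f x))))"

definition sub_quadratic :: "(real \<Rightarrow> real) \<Rightarrow> bool" where
  "sub_quadratic \<l> \<longleftrightarrow> ((\<lambda>u. \<l> u / u\<^sup>2) \<longlongrightarrow> 0) at_top"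

primrec gd_iterate :: "('a::euclidean_space \<Rightarrow> real) \<Rightarrow> real \<Rightarrow> 'a \<Rightarrow> nat \<Rightarrow> 'a" where
  "gd_iterate f \<eta> x0 0 = x0"
| "gd_iterate f \<eta> x0 (Suc t) = gd_iterate f \<eta> x0 t - \<eta> *\<^sub>R grad f (gd_iterate f \<eta> x0 t)"

end

theory Submission
  imports Defs
begin

text \<open>
  Write \<open>u\<close> for the norm of the gradient at a point \<open>x\<close> of \<open>X\<close>. Everything rests on the quadratic
  upper bound
  \<open>f y \<le> f x + (y - x) \<bullet> grad f x + \<l> (2 * u) / 2 * (norm (y - x))\<^sup>2\<close>
  for all \<open>y\<close> within distance \<open>u / \<l> (2 * u)\<close> of \<open>x\<close>, together with the fact that all such \<open>y\<close> lie
  in \<open>X\<close> (\<open>quadratic_bound\<close>). Inserting \<open>y = x - \<eta> *\<^sub>R grad f x\<close> with \<open>\<eta> \<le> 1 / \<l> (2 * u)\<close> gives the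
  decrease \<open>\<eta> * u\<^sup>2 / 2\<close> of \<open>f\<close> (\<open>gradient_step\<close>). With the largest such \<open>\<eta>\<close>, the decrease cannot
  exceed the gap between \<open>f x\<close> and the infimum, so \<open>u\<^sup>2 \<le> 2 * \<l> (2 * u) * (f x - fstar)\<close>
  (\<open>grad_square_le\<close>). On the sublevel set of \<open>x0\<close> this puts \<open>u\<close> into the set whose supremum
  is \<open>G\<close>, a bounded set because \<open>\<l>\<close> is sub-quadratic. Hence \<open>\<l> (2 * u) \<le> L\<close> there, every step of
  size at most \<open>1 / L\<close> is admissible, the iterates never leave the sublevel set, and the decreases
  telescope.

  The quadratic bound needs the gradient to grow in a controlled way along the segment from \<open>x\<close> to
  \<open>y\<close>. As long as its norm stays below \<open>2 * u\<close>, it grows at rate at most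
  \<open>\<l> (2 * u) * norm (y - x)\<close>; if \<open>y\<close> is strictly closer to \<open>x\<close> than \<open>u / \<l> (2 * u)\<close>, it therefore
  increases by less than \<open>u\<close> and never reaches \<open>2 * u\<close> (\<open>self_bounded_growth\<close>). The Hessian bound
  holds only almost everywhere, and the given segment may lie entirely in the exceptional null set.
  However, the segments from \<open>x\<close> to
  almost every endpoint meet this null set in a set of parameters of measure zero
  (\<open>AE_segment_avoids_null_set\<close>). All of them start at the same point \<open>x\<close> with the same gradient,
  so along them the argument works without any joint continuity of the gradient; since \<open>f\<close> is
  continuous and the good endpoints are dense, the resulting inequality for \<open>f\<close> passes to every
  endpoint.

  That the ball lies in \<open>X\<close> follows from the closedness of the sublevel sets. If it did not, take
  a point outside \<open>X\<close> nearest to \<open>x\<close>. The open ball up to that point is contained in \<open>X\<close>, and the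
  quadratic bound keeps it inside one sublevel set; this set is closed, so it contains the point as
  well (\<open>cball_subset_domain\<close>).
\<close>

section \<open>Absolute continuity on an interval\<close>

lemma division_of_lmeasurable:
  assumes "D division_of S"
  shows "S \<in> lmeasurable"
proof (rule lmeasurable_compact)
  have "compact (\<Union>D)"
    using division_of_finite[OF assms] division_ofD(4)[OF assms]
    by (intro compact_Union) (auto, metis compact_cbox)
  then show "compact S" using division_ofD(6)[OF assms] by simp
qed

lemma sum_length_division:
  fixes S :: "real set"
  assumes "D division_of S"
  shows "(\<Sum>K\<in>D. Sup K - Inf K) = measure lebesgue S"
proof -
  have K: "((\<lambda>x. 1) has_integral Sup K - Inf K) K" if K: "K \<in> D" for K
  proof -
    from division_ofD(3,4)[OF assms K] obtain c d where "K = {c..d}" "c \<le> d"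
      by (auto simp: box_real)
    then show ?thesis using has_integral_const_real[of "1::real" c d] by simp
  qed
  have "((\<lambda>x. 1) has_integral (\<Sum>K\<in>D. Sup K - Inf K)) S"
    using has_integral_combine_division[OF assms K] by simp
  moreover have "S \<in> lmeasurable"
    by (rule division_of_lmeasurable[OF assms])
  ultimately show ?thesis
    by (simp add: lmeasure_integral integral_unique)
qed

text \<open>A proof without integration: an open set \<open>T\<close> of small measure covers the exceptional null set
  \<open>N\<close>. A gauge keeps intervals tagged in \<open>N\<close> inside \<open>T\<close>, and makes the difference quotient at most
  \<open>M + \<epsilon>\<close> on intervals tagged elsewhere. In a fine tagged division, absolute continuity then makes
  the total increment over the intervals of the first kind less than \<open>\<epsilon>\<close>, while the others
  contribute at most \<open>(M + \<epsilon>) * (d - c)\<close>.\<close>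
lemma abs_continuous_increment_le:
  fixes g :: "real \<Rightarrow> 'b::real_normed_vector"
  assumes ac: "abs_continuous_on_interval a b g"
    and "0 \<le> M"
    and ord: "a \<le> c" "c \<le> d" "d \<le> b"
    and ae: "AE s in lebesgue. s \<in> {c..d} \<longrightarrow>
               (\<exists>v. (g has_vector_derivative v) (at s) \<and> norm v \<le> M)"
  shows "norm (g d - g c) \<le> M * (d - c)"
proof -
  define P where "P s \<longleftrightarrow> (\<exists>v. (g has_vector_derivative v) (at s) \<and> norm v \<le> M)" for s
  obtain N where N: "N \<in> null_sets lebesgue" and PN: "\<And>s. s \<in> {c..d} - N \<Longrightarrow> P s"
  proof -
    from ae obtain N where "{s \<in> space lebesgue. \<not> (s \<in> {c..d} \<longrightarrow> P s)} \<subseteq> N" "N \<in> null_sets lebesgue"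
      unfolding P_def[symmetric] eventually_ae_filter by auto
    then show ?thesis using that[of N] by auto
  qed
  have step: "norm (g d - g c) \<le> M * (d - c) + \<epsilon> * (d - c + 1)" if e: "\<epsilon> > 0" for \<epsilon>
  proof -
    from ac[unfolded abs_continuous_on_interval_def] e obtain \<delta> where "\<delta> > 0" and
      \<delta>: "\<And>D S. D division_of S \<Longrightarrow> S \<subseteq> {a..b} \<Longrightarrow> (\<Sum>K\<in>D. Sup K - Inf K) < \<delta> \<Longrightarrow>
           (\<Sum>K\<in>D. dist (g (Sup K)) (g (Inf K))) < \<epsilon>" by meson
    obtain T where T: "open T" "N \<subseteq> T" "(T - N) \<in> lmeasurable" "emeasure lebesgue (T - N) < ennreal \<delta>"
      using sets_lebesgue_outer_open[OF _ \<open>\<delta> > 0\<close>] N by (metis null_setsD2)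
    have "emeasure lebesgue T = emeasure lebesgue (T - N)"
      using emeasure_Diff_null_set[OF N] T(1) by (simp add: borel_open)
    then have T_small: "emeasure lebesgue T < ennreal \<delta>" using T by simp
    have T_lmeas: "T \<in> lmeasurable"
      using T_small T(1) by (auto simp: fmeasurable_def borel_open intro: less_trans)
    have mT: "measure lebesgue T < \<delta>"
      using T_small T_lmeas by (simp add: emeasure_eq_measure2 ennreal_less_iff)
    have "\<exists>r>0. (s \<in> N \<longrightarrow> ball s r \<subseteq> T) \<and>
            (P s \<longrightarrow> (\<forall>t. \<bar>t - s\<bar> < r \<longrightarrow> norm (g t - g s) \<le> (M + \<epsilon>) * \<bar>t - s\<bar>))" for s
    proof -
      obtain r1 where r1: "r1 > 0" "s \<in> N \<longrightarrow> ball s r1 \<subseteq> T"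
        using T by (metis openE subsetD zero_less_one)
      obtain r2 where r2: "r2 > 0" "P s \<longrightarrow> (\<forall>t. \<bar>t - s\<bar> < r2 \<longrightarrow> norm (g t - g s) \<le> (M + \<epsilon>) * \<bar>t - s\<bar>)"
      proof (cases "P s")
        case True
        then obtain v where v: "(g has_vector_derivative v) (at s)" "norm v \<le> M"
          by (auto simp: P_def)
        then obtain r where "r > 0"
          and r: "\<And>t. norm (t - s) < r \<Longrightarrow> norm (g t - g s - (t - s) *\<^sub>R v) \<le> \<epsilon> * norm (t - s)"
          using e unfolding has_vector_derivative_def has_derivative_at_alt by blast
        have "norm (g t - g s) \<le> (M + \<epsilon>) * \<bar>t - s\<bar>" if "\<bar>t - s\<bar> < r" for t
        proof -
          have "norm (g t - g s) \<le> norm (g t - g s - (t - s) *\<^sub>R v) + norm ((t - s) *\<^sub>R v)"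
            by (metis diff_add_cancel norm_triangle_ineq)
          also have "\<dots> \<le> \<epsilon> * \<bar>t - s\<bar> + \<bar>t - s\<bar> * M"
            using r[of t] that v(2) by (intro add_mono) (auto simp: mult_left_mono)
          finally show ?thesis by (simp add: algebra_simps)
        qed
        with \<open>r > 0\<close> show ?thesis using that by blast
      qed (use that[of 1] in auto)
      show ?thesis
        using r1 r2 by (intro exI[of _ "min r1 r2"]) (auto simp: subset_iff)
    qed
    then obtain r where r: "\<And>s. r s > 0" "\<And>s. s \<in> N \<Longrightarrow> ball s (r s) \<subseteq> T"
      and rP: "\<And>s t. P s \<Longrightarrow> \<bar>t - s\<bar> < r s \<Longrightarrow> norm (g t - g s) \<le> (M + \<epsilon>) * \<bar>t - s\<bar>"
      by metis
    have "gauge (\<lambda>s. ball s (r s))" using r(1) by (intro gauge_ball_dependent) auto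
    then obtain p where p: "p tagged_division_of {c..d}" and fine: "(\<lambda>s. ball s (r s)) fine p"
      by (rule fine_division_exists_real)
    define B where "B = {q \<in> p. fst q \<in> N}"
    have fin: "finite p" "finite B" and Bp: "B \<subseteq> p" using p by (auto simp: B_def)
    have K: "\<exists>u v. K = {u..v} \<and> u \<le> s \<and> s \<le> v \<and> {u..v} \<subseteq> ball s (r s) \<and> c \<le> u \<and> v \<le> d"
      if "(s, K) \<in> p" for s K
      using tagged_division_ofD(2,3,4)[OF p that] fine that unfolding fine_def
      by (fastforce simp: box_real)
    \<comment> \<open>Two tagged pairs may share a degenerate interval, so passing from a sum over \<open>B\<close> to
      the sum over its intervals requires a summand that vanishes on degenerate ones. The value at the empty set is fixed
      because \<open>Sup\<close> and \<open>Inf\<close> are unspecified there.\<close>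
    define h where "h K = (if K = {} then 0 else dist (g (Sup K)) (g (Inf K)))" for K
    have tB: "B tagged_division_of \<Union> (snd ` B)"
      using p Bp tagged_partial_division_of_Union_self tagged_partial_division_subset
        tagged_division_of_def by metis
    have DB: "snd ` B division_of \<Union> (snd ` B)"
      by (rule division_of_tagged_division[OF tB])
    have UT: "\<Union> (snd ` B) \<subseteq> T"
    proof
      fix t assume "t \<in> \<Union> (snd ` B)"
      then obtain s K where sK: "(s, K) \<in> p" "s \<in> N" "t \<in> K" by (auto simp: B_def)
      then show "t \<in> T" using K[OF sK(1)] r(2)[OF sK(2)] by blast
    qed
    have Uab: "\<Union> (snd ` B) \<subseteq> {a..b}"
      using tagged_division_ofD(3)[OF p] Bp ord by fastforce
    have "(\<Sum>K\<in>snd ` B. Sup K - Inf K) = measure lebesgue (\<Union> (snd ` B))"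
      by (rule sum_length_division[OF DB])
    also have "\<dots> \<le> measure lebesgue T"
      using UT T_lmeas division_of_lmeasurable[OF DB]
      by (intro measure_mono_fmeasurable) auto
    finally have "(\<Sum>K\<in>snd ` B. Sup K - Inf K) < \<delta>" using mT by simp
    from \<delta>[OF DB Uab this] have "sum h (snd ` B) < \<epsilon>"
      using division_ofD(3)[OF DB] by (simp add: h_def)
    moreover have "(\<Sum>(s, K)\<in>B. h K) = sum h (snd ` B)"
    proof (rule sum.over_tagged_division_lemma[OF tB])
      fix u v :: real assume "box u v = {}"
      then have "cbox u v = {} \<or> cbox u v = {u}" by (auto simp: box_real)
      then show "h (cbox u v) = 0" by (auto simp: h_def)
    qed
    ultimately have bad: "(\<Sum>(s, K)\<in>B. h K) < \<epsilon>" by simp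
    have good: "(\<Sum>(s, K)\<in>p - B. h K) \<le> (M + \<epsilon>) * (d - c)"
    proof -
      have P_tag: "P s" if "(s, K) \<in> p - B" for s K
        using that K by (intro PN) (fastforce simp: B_def)
      have "h K \<le> (M + \<epsilon>) * (Sup K - Inf K)" if sK: "(s, K) \<in> p - B" for s K
      proof -
        obtain u v where uv: "K = {u..v}" "u \<le> s" "s \<le> v" "{u..v} \<subseteq> ball s (r s)"
          using K sK by blast
        then have "u \<in> ball s (r s)" "v \<in> ball s (r s)"
          by (meson atLeastAtMost_iff order_refl order_trans subsetD)+
        then have "norm (g u - g s) \<le> (M + \<epsilon>) * \<bar>u - s\<bar>" "norm (g v - g s) \<le> (M + \<epsilon>) * \<bar>v - s\<bar>"
          using rP[OF P_tag[OF sK]] by (auto simp: dist_real_def)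
        moreover have "dist (g v) (g u) \<le> norm (g v - g s) + norm (g u - g s)"
          by (metis dist_norm dist_triangle2)
        ultimately have "dist (g v) (g u) \<le> (M + \<epsilon>) * (v - u)"
          using uv by (simp add: algebra_simps)
        then show ?thesis using uv by (simp add: h_def)
      qed
      then have "(\<Sum>(s, K)\<in>p - B. h K) \<le> (\<Sum>(s, K)\<in>p - B. (M + \<epsilon>) * (Sup K - Inf K))"
        by (intro sum_mono) auto
      also have "\<dots> \<le> (\<Sum>(s, K)\<in>p. (M + \<epsilon>) * (Sup K - Inf K))"
        using e fin \<open>0 \<le> M\<close> K by (intro sum_mono2) (auto, fastforce)
      also have "\<dots> = (M + \<epsilon>) * (\<Sum>(s, K)\<in>p. Sup K - Inf K)"
        by (simp add: sum_distrib_left case_prod_unfold)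
      also have "\<dots> = (M + \<epsilon>) * (d - c)"
        using additive_tagged_division_1[OF ord(2) p, of "\<lambda>x. x"] by simp
      finally show ?thesis .
    qed
    have "norm (g d - g c) = norm (\<Sum>(s, K)\<in>p. g (Sup K) - g (Inf K))"
      using additive_tagged_division_1[OF ord(2) p, of g] by simp
    also have "\<dots> \<le> (\<Sum>(s, K)\<in>p. h K)"
      using K by (intro sum_norm_le) (fastforce simp: h_def dist_norm)
    also have "\<dots> = (\<Sum>(s, K)\<in>p - B. h K) + (\<Sum>(s, K)\<in>B. h K)"
      using sum.subset_diff[OF Bp fin(1)] by blast
    also have "\<dots> \<le> (M + \<epsilon>) * (d - c) + \<epsilon>" using good bad by simp
    finally show ?thesis by (simp add: algebra_simps)
  qed
  show ?thesis
  proof (rule field_le_epsilon)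
    fix e :: real assume "e > 0"
    then show "norm (g d - g c) \<le> M * (d - c) + e"
      using step[of "e / (d - c + 1)"] ord by simp
  qed
qed

lemma abs_continuous_imp_continuous_on:
  assumes "abs_continuous_on_interval a b g"
  shows "continuous_on {a..b} g"
  unfolding continuous_on_iff
proof (intro ballI allI impI)
  fix s and \<epsilon> :: real
  assume s: "s \<in> {a..b}" and "\<epsilon> > 0"
  then obtain \<delta> where "\<delta> > 0" and
    \<delta>: "\<And>D S. D division_of S \<Longrightarrow> S \<subseteq> {a..b} \<Longrightarrow> (\<Sum>K\<in>D. Sup K - Inf K) < \<delta> \<Longrightarrow>
         (\<Sum>K\<in>D. dist (g (Sup K)) (g (Inf K))) < \<epsilon>"
    using assms unfolding abs_continuous_on_interval_def by meson
  have "dist (g t) (g s) < \<epsilon>" if t: "t \<in> {a..b}" "dist t s < \<delta>" for t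
  proof -
    have "{{min s t..max s t}} division_of {min s t..max s t}"
      using division_of_self[of "min s t" "max s t"] by (simp add: box_real)
    from \<delta>[OF this] s t show ?thesis
      by (cases "s \<le> t") (auto simp: dist_real_def dist_commute)
  qed
  with \<open>\<delta> > 0\<close> show "\<exists>\<delta>>0. \<forall>t\<in>{a..b}. dist t s < \<delta> \<longrightarrow> dist (g t) (g s) < \<epsilon>" by blast
qed

text \<open>This is applied to the gradient along a segment of length \<open>r\<close>. A barrier argument replaces
  Gronwall's inequality. At the first time \<open>d\<close> at which the norm of \<open>g\<close> reaches \<open>2 * u\<close>, the
  speed has been at most \<open>r * \<l> (2 * u)\<close> so far, hence \<open>g\<close> has moved by less than \<open>u\<close> and its norm
  is still less than \<open>2 * u\<close>, a contradiction.\<close>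
lemma self_bounded_growth:
  fixes g :: "real \<Rightarrow> 'b::real_normed_vector"
  assumes ac: "abs_continuous_on_interval 0 1 g"
    and mono: "mono_on {0..} \<l>" and pos: "\<And>w. 0 \<le> w \<Longrightarrow> 0 < \<l> w"
    and u: "u = norm (g 0)" and r: "0 \<le> r" "r * \<l> (2 * u) < u"
    and ae: "AE s in lebesgue. s \<in> {0..1} \<longrightarrow>
               (\<exists>v. (g has_vector_derivative v) (at s) \<and> norm v \<le> r * \<l> (norm (g s)))"
    and t: "t \<in> {0..1}"
  shows "norm (g t - g 0) \<le> r * \<l> (2 * u) * t"
proof -
  have u0: "0 \<le> u" using u by simp
  have M0: "0 \<le> r * \<l> (2 * u)" using r pos[of "2 * u"] u0 by simp
  have inc: "norm (g d - g 0) \<le> r * \<l> (2 * u) * d"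
    if d: "d \<in> {0..1}" and small: "\<And>s. 0 \<le> s \<Longrightarrow> s < d \<Longrightarrow> norm (g s) \<le> 2 * u" for d
  proof -
    \<comment> \<open>The bound \<open>2 * u\<close> is known only strictly before \<open>d\<close>; the single time \<open>d\<close> is negligible.\<close>
    have "AE s in lebesgue. s \<noteq> d"
      by (intro AE_completion AE_lborel_singleton)
    with ae have "AE s in lebesgue. s \<in> {0..d} \<longrightarrow>
        (\<exists>v. (g has_vector_derivative v) (at s) \<and> norm v \<le> r * \<l> (2 * u))"
    proof eventually_elim
      case (elim s)
      show ?case
      proof
        assume s: "s \<in> {0..d}"
        then obtain v where v: "(g has_vector_derivative v) (at s)" "norm v \<le> r * \<l> (norm (g s))"
          using elim d by auto
        have "\<l> (norm (g s)) \<le> \<l> (2 * u)"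
          using small[of s] s elim u0 by (intro mono_onD[OF mono]) auto
        then have "norm v \<le> r * \<l> (2 * u)"
          using v(2) r(1) mult_left_mono order_trans by blast
        then show "\<exists>v. (g has_vector_derivative v) (at s) \<and> norm v \<le> r * \<l> (2 * u)"
          using v(1) by blast
      qed
    qed
    from abs_continuous_increment_le[OF ac M0 _ _ _ this] d show ?thesis by simp
  qed
  define A where "A = {s \<in> {0..1}. 2 * u \<le> norm (g s)}"
  have "A = {}"
  proof (rule ccontr)
    assume "A \<noteq> {}"
    have "closed A"
      unfolding A_def
      by (intro continuous_on_closed_Collect_le
          continuous_intros abs_continuous_imp_continuous_on[OF ac])
    have bd: "bdd_below A" by (auto simp: A_def bdd_below_def)
    define d where "d = Inf A"
    have dA: "d \<in> A"
      unfolding d_def using \<open>A \<noteq> {}\<close> bd \<open>closed A\<close> by (rule closed_contains_Inf)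
    have "norm (g s) \<le> 2 * u" if "0 \<le> s" "s < d" for s
      using that cInf_lower[OF _ bd, of s] dA unfolding d_def[symmetric] by (force simp: A_def)
    then have "norm (g d - g 0) \<le> r * \<l> (2 * u) * d"
      using dA by (intro inc) (auto simp: A_def)
    also have "\<dots> \<le> r * \<l> (2 * u)"
      using M0 dA by (intro mult_left_le) (auto simp: A_def)
    also have "\<dots> < u" by fact
    finally have "norm (g d) < 2 * u"
      using norm_triangle_sub[of "g d" "g 0"] u by simp
    with dA show False by (simp add: A_def)
  qed
  have "norm (g s) \<le> 2 * u" if "0 \<le> s" "s < t" for s
  proof -
    have "s \<notin> A" using \<open>A = {}\<close> by simp
    then show ?thesis using t that by (simp add: A_def)
  qed
  then show ?thesis using t by (intro inc)
qed

section \<open>Null sets and segments\<close>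

text \<open>For each fixed \<open>s > 0\<close>, the endpoints \<open>y\<close> for which the point at parameter \<open>s\<close> lies in \<open>N\<close> form
  an affine image of \<open>N\<close>, which is null. Fubini's theorem exchanges the roles of \<open>s\<close> and \<open>y\<close>. This
  plays the part of polar coordinates around \<open>x\<close>.\<close>
lemma AE_segment_avoids_null_set:
  fixes x :: "'a::euclidean_space"
  assumes N: "N \<in> null_sets lborel"
  shows "AE y in lborel. AE s in lborel. 0 < s \<longrightarrow> x + s *\<^sub>R (y - x) \<notin> N"
proof -
  have Nb[measurable]: "N \<in> sets borel" using N by auto
  have "AE y in lborel. 0 < s \<longrightarrow> x + s *\<^sub>R (y - x) \<notin> N" for s :: real
  proof (cases "0 < s")
    case True
    define T where "T z = (x - (1/s) *\<^sub>R x) + (1/s) *\<^sub>R z" for z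
    have inv: "x + s *\<^sub>R (T z - x) = z" for z
      using True by (simp add: T_def algebra_simps)
    have [measurable]: "T \<in> borel_measurable borel" unfolding T_def by measurable
    have "(AE y in distr lborel borel T. x + s *\<^sub>R (y - x) \<notin> N) \<longleftrightarrow> 
       (AE z in lborel. x + s *\<^sub>R (T z - x) \<notin> N)"
      by (rule AE_distr_iff) simp_all
    also have "\<dots>" using AE_not_in[OF N] by (simp add: inv)
    finally have "AE y in density (distr lborel borel T) (\<lambda>_. \<bar>1/s\<bar>^DIM('a)). x + s *\<^sub>R (y - x) \<notin> N"
      by (subst AE_density) auto
    then have "AE y in lborel. x + s *\<^sub>R (y - x) \<notin> N"
      unfolding T_def using True by (subst lborel_affine[of "1/s" "x - (1/s) *\<^sub>R x"]) auto
    then show ?thesis by auto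
  qed auto
  then have "AE s in lborel. AE y in lborel. 0 < (s::real) \<longrightarrow> x + s *\<^sub>R (y - x) \<notin> N"
    by auto
  moreover have "{q \<in> space (lborel \<Otimes>\<^sub>M lborel). 0 < fst q \<longrightarrow> x + fst q *\<^sub>R (snd q - x) \<notin> N}
      \<in> sets (lborel \<Otimes>\<^sub>M lborel)"
    by measurable
  ultimately show ?thesis
    by (subst lborel_pair.AE_commute[symmetric])
qed

lemma AE_dense:
  fixes U :: "'a::euclidean_space set"
  assumes "AE y in lborel. P y" and U: "open U" "y \<in> U"
  shows "y \<in> closure {z \<in> U. P z}"
proof (rule ccontr)
  assume "y \<notin> closure {z \<in> U. P z}"
  define V where "V = U - closure {z \<in> U. P z}"
  have "open V" "y \<in> V" "\<And>z. z \<in> V \<Longrightarrow> \<not> P z"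
    using U \<open>y \<notin> _\<close> closure_subset[of "{z \<in> U. P z}"] by (auto simp: V_def)
  obtain N where N: "{z. \<not> P z} \<subseteq> N" "N \<in> null_sets lborel"
    using assms(1) unfolding eventually_ae_filter by auto
  have "V \<in> null_sets lborel"
    using N \<open>open V\<close> \<open>\<And>z. z \<in> V \<Longrightarrow> \<not> P z\<close>
    by (intro null_sets_subset[OF N(2)]) auto
  then have "V \<in> null_sets lebesgue" by (rule null_sets_completionI)
  then have "negligible V" by (simp add: negligible_iff_null_sets)
  with \<open>open V\<close> \<open>y \<in> V\<close> show False using open_not_negligible by blast
qed

section \<open>Gradients\<close>
lemma GDERIV_unique:
  assumes "GDERIV f x :> D" "GDERIV f x :> E"
  shows "D = E"
  using has_derivative_unique[OF assms[unfolded gderiv_def]]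
  by (metis vector_eq_ldot)

lemma GDERIV_grad:
  fixes f :: "'a::euclidean_space \<Rightarrow> real"
  assumes "f differentiable (at x)"
  shows "GDERIV f x :> grad f x"
proof -
  obtain D where D: "(f has_derivative D) (at x)"
    using assms by (auto simp: differentiable_def)
  have "D = (\<lambda>h. h \<bullet> adjoint D 1)"
    using adjoint_works[OF has_derivative_linear[OF D]] by (auto simp: fun_eq_iff)
  with D have "GDERIV f x :> adjoint D 1"
    by (simp add: gderiv_def)
  moreover from this have "grad f x = adjoint D 1"
    unfolding grad_def by (intro the_equality) (auto intro: GDERIV_unique)
  ultimately show ?thesis by simp
qed

section \<open>The quadratic upper bound under generalized smoothness\<close>

locale ell_smooth_closed =
  fixes X :: "'a::euclidean_space set" and f :: "'a \<Rightarrow> real" and \<l> :: "real \<Rightarrow> real"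
  assumes open_X: "open X"
    and differentiable_f: "f differentiable_on X"
    and closed_sublevel: "\<And>a. closed {x \<in> X. f x \<le> a}"
    and mono_l: "mono_on {0..} \<l>"
    and l_pos: "\<And>u. 0 \<le> u \<Longrightarrow> 0 < \<l> u"
    and smooth: "ell_smooth_on X \<l> f"
begin

lemma grad_derivative: "x \<in> X \<Longrightarrow> (f has_derivative (\<lambda>h. h \<bullet> grad f x)) (at x)"
  using GDERIV_grad[of f x] differentiable_f open_X
  by (simp add: gderiv_def differentiable_on_eq_differentiable_at)

lemma grad_increment_on_good_segment:
  assumes seg: "closed_segment x y \<subseteq> X"
    and small: "norm (y - x) * \<l> (2 * norm (grad f x)) < norm (grad f x)"
    and ae: "AE s in lebesgue. s \<in> {0..1} \<longrightarrow> (\<exists>H. (grad f has_derivative H) (at (linepath x y s)) \<and>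
               onorm H \<le> \<l> (norm (grad f (linepath x y s))))"
    and s: "s \<in> {0..1}"
  shows "norm (grad f (linepath x y s) - grad f x)
           \<le> norm (y - x) * \<l> (2 * norm (grad f x)) * s"
proof -
  let ?g = "grad f \<circ> linepath x y"
  have ac: "abs_continuous_on_interval 0 1 ?g"
    using smooth seg by (simp add: ell_smooth_on_def)
  have ae': "AE s in lebesgue. s \<in> {0..1} \<longrightarrow> (\<exists>v. (?g has_vector_derivative v) (at s) \<and>
               norm v \<le> norm (y - x) * \<l> (norm (?g s)))"
    using ae
  proof eventually_elim
    case (elim s)
    show ?case
    proof
      assume "s \<in> {0..1}"
      then obtain H where H: "(grad f has_derivative H) (at (linepath x y s))"
          "onorm H \<le> \<l> (norm (?g s))" using elim by auto
      have "(linepath x y has_vector_derivative (y - x)) (at s)"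
        by (rule has_vector_derivative_linepath_within)
      then have "(?g has_derivative H \<circ> (\<lambda>h. h *\<^sub>R (y - x))) (at s)"
        unfolding has_vector_derivative_def using H(1) by (rule diff_chain_at)
      then have "(?g has_vector_derivative H (y - x)) (at s)"
        using linear_scale[OF has_derivative_linear[OF H(1)]]
        by (simp add: has_vector_derivative_def o_def)
      moreover have "norm (H (y - x)) \<le> onorm H * norm (y - x)"
        by (rule onorm[OF has_derivative_bounded_linear[OF H(1)]])
      then have "norm (H (y - x)) \<le> norm (y - x) * \<l> (norm (?g s))"
        using mult_left_mono[OF H(2), of "norm (y - x)"] by (simp add: mult.commute)
      ultimately show "\<exists>v. (?g has_vector_derivative v) (at s) \<and>
               norm v \<le> norm (y - x) * \<l> (norm (?g s))" by blast
    qed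
  qed
  show ?thesis
    using self_bounded_growth[OF ac mono_l l_pos, of "norm (grad f x)" "norm (y - x)" s] small ae' s
    by (simp add: linepath_0')
qed

text \<open>The gradient increment is at most linear in \<open>s\<close>, so the function \<open>\<phi>\<close>, which is \<open>f\<close> along the
  segment minus the claimed bound up to a constant, has a nonpositive derivative.\<close>
lemma quadratic_bound_on_good_segment:
  assumes seg: "closed_segment x y \<subseteq> X"
    and small: "norm (y - x) * \<l> (2 * norm (grad f x)) < norm (grad f x)"
    and ae: "AE s in lebesgue. s \<in> {0..1} \<longrightarrow> (\<exists>H. (grad f has_derivative H) (at (linepath x y s)) \<and>
               onorm H \<le> \<l> (norm (grad f (linepath x y s))))"
  shows "f y \<le> f x + (y - x) \<bullet> grad f x + \<l> (2 * norm (grad f x)) / 2 * (norm (y - x))\<^sup>2"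
proof -
  define M where "M = \<l> (2 * norm (grad f x))"
  define F where "F = f \<circ> linepath x y"
  define \<phi> where "\<phi> s = F s - s * ((y - x) \<bullet> grad f x) - M / 2 * (norm (y - x))\<^sup>2 * s\<^sup>2" for s
  have "\<phi> 1 \<le> \<phi> 0"
  proof (rule DERIV_nonpos_imp_nonincreasing[of 0 1 \<phi>])
    fix s :: real
    assume s: "0 \<le> s" "s \<le> 1"
    let ?d = "grad f (linepath x y s) - grad f x"
    have "linepath x y s \<in> X"
      using seg s linepath_in_path[of s x y] by auto
    note chain = diff_chain_at[OF
        has_vector_derivative_linepath_within[unfolded has_vector_derivative_def]
        grad_derivative[OF this]]
    have "(F has_real_derivative (y - x) \<bullet> grad f (linepath x y s)) (at s)"
      unfolding F_def has_field_derivative_def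
      by (rule has_derivative_eq_rhs[OF chain]) (simp add: fun_eq_iff)
    then have "(\<phi> has_real_derivative (y - x) \<bullet> grad f (linepath x y s) - (y - x) \<bullet> grad f x
                 - M * (norm (y - x))\<^sup>2 * s) (at s)"
      unfolding \<phi>_def by (auto intro!: derivative_eq_intros)
    moreover have "(y - x) \<bullet> ?d \<le> norm (y - x) * (norm (y - x) * M * s)"
    proof -
      have "norm ?d \<le> norm (y - x) * M * s"
        unfolding M_def using s by (intro grad_increment_on_good_segment[OF seg small ae]) auto
      then have "norm (y - x) * norm ?d \<le> norm (y - x) * (norm (y - x) * M * s)"
        by (intro mult_left_mono) auto
      then show ?thesis using norm_cauchy_schwarz[of "y - x" ?d] by linarith
    qed
    moreover from this have "(y - x) \<bullet> grad f (linepath x y s) - (y - x) \<bullet> grad f x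
                 - M * (norm (y - x))\<^sup>2 * s \<le> 0"
      by (simp add: inner_diff_right power2_eq_square mult_ac)
    ultimately show "\<exists>v. (\<phi> has_real_derivative v) (at s) \<and> v \<le> 0"
      by blast
  qed simp
  then show ?thesis
    by (simp add: \<phi>_def F_def M_def linepath_0' linepath_1')
qed

lemma AE_good_segment:
  "AE y in lborel. AE s in lebesgue. 0 < s \<and> linepath x y s \<in> X \<longrightarrow>
     (\<exists>H. (grad f has_derivative H) (at (linepath x y s)) \<and>
          onorm H \<le> \<l> (norm (grad f (linepath x y s))))"
proof -
  define P where "P z \<longleftrightarrow> (\<exists>H. (grad f has_derivative H) (at z) \<and> onorm H \<le> \<l> (norm (grad f z)))" for z
  have "AE z in lborel. z \<in> X \<longrightarrow> P z"
    using smooth unfolding ell_smooth_on_def P_def by (simp add: AE_completion_iff)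
  then obtain N where N: "{z. \<not> (z \<in> X \<longrightarrow> P z)} \<subseteq> N" "N \<in> null_sets lborel"
    unfolding eventually_ae_filter by auto
  from AE_segment_avoids_null_set[OF N(2), of x]
  have "AE y in lborel. AE s in lebesgue. 0 < s \<and> linepath x y s \<in> X \<longrightarrow> P (linepath x y s)"
  proof eventually_elim
    case (elim y)
    then have "AE s in lebesgue. 0 < s \<longrightarrow> x + s *\<^sub>R (y - x) \<notin> N" by (rule AE_completion)
    then show ?case
      by eventually_elim (use N(1) in \<open>auto simp: linepath_def algebra_simps\<close>)
  qed
  then show ?thesis by (simp add: P_def)
qed

text \<open>Both sides of the inequality are continuous in \<open>y\<close>, so it suffices to have it on the dense set
  of endpoints \<open>y\<close> whose segment from \<open>x\<close> is good at almost every parameter.\<close>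
lemma quadratic_bound_on_ball:
  assumes x: "x \<in> X" and ball: "ball x \<rho> \<subseteq> X"
    and \<rho>: "\<rho> * \<l> (2 * norm (grad f x)) \<le> norm (grad f x)"
    and y: "y \<in> ball x \<rho>"
  shows "f y \<le> f x + (y - x) \<bullet> grad f x + \<l> (2 * norm (grad f x)) / 2 * (norm (y - x))\<^sup>2"
proof -
  define M where "M = \<l> (2 * norm (grad f x))"
  have M: "M > 0" by (simp add: M_def l_pos)
  define Q where "Q y \<longleftrightarrow> (AE s in lebesgue. 0 < s \<and> linepath x y s \<in> X \<longrightarrow>
     (\<exists>H. (grad f has_derivative H) (at (linepath x y s)) \<and>
          onorm H \<le> \<l> (norm (grad f (linepath x y s)))))" for y
  define h where "h y = f y - (f x + (y - x) \<bullet> grad f x + M / 2 * (norm (y - x))\<^sup>2)" for y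
  have good: "h z \<le> 0" if z: "z \<in> ball x \<rho>" "Q z" for z
  proof -
    have seg: "closed_segment x z \<subseteq> X"
    proof -
      have "0 < \<rho>" using z(1) by (auto intro: le_less_trans[OF zero_le_dist])
      then have "closed_segment x z \<subseteq> ball x \<rho>"
        using z(1) by (intro closed_segment_subset) auto
      with ball show ?thesis by blast
    qed
    have "AE s in lebesgue. s \<noteq> (0::real)"
      by (intro AE_completion AE_lborel_singleton)
    with z(2)[unfolded Q_def] have ae: "AE s in lebesgue. s \<in> {0..1} \<longrightarrow>
        (\<exists>H. (grad f has_derivative H) (at (linepath x z s)) \<and>
             onorm H \<le> \<l> (norm (grad f (linepath x z s))))"
      by eventually_elim (use seg linepath_in_path[of _ x z] in auto)
    have "norm (z - x) * M < \<rho> * M"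
      using z(1) M by (simp add: dist_norm norm_minus_commute)
    then have "norm (z - x) * M < norm (grad f x)" using \<rho> by (simp add: M_def)
    from quadratic_bound_on_good_segment[OF seg this[unfolded M_def] ae] show ?thesis
      by (simp add: h_def M_def)
  qed
  have "continuous_on X h"
    unfolding h_def using differentiable_imp_continuous_on[OF differentiable_f]
    by (intro continuous_intros)
  then have "continuous (at y) h"
    using open_X y ball continuous_on_eq_continuous_at by blast
  moreover have "y \<in> closure {z \<in> ball x \<rho>. Q z}"
    using AE_good_segment[of x] y by (intro AE_dense) (auto simp: Q_def)
  then obtain z where z: "\<And>n. z n \<in> {z \<in> ball x \<rho>. Q z}" "z \<longlonglongrightarrow> y"
    unfolding closure_sequential by blast
  ultimately have "(\<lambda>n. h (z n)) \<longlonglongrightarrow> h y"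
    by (simp add: continuous_at_sequentially o_def)
  then have "h y \<le> 0"
    by (rule LIMSEQ_le_const2) (use z(1) good in auto)
  then show ?thesis by (simp add: h_def M_def)
qed

text \<open>Let \<open>z\<close> be a nearest point to \<open>x\<close> in \<open>cball x r - X\<close>. The open ball around \<open>x\<close> with \<open>z\<close> on its
  boundary lies in \<open>X\<close>, so the quadratic bound applies there and bounds \<open>f\<close> by a constant \<open>a\<close>. The
  sublevel set at \<open>a\<close> is closed and therefore contains \<open>z\<close>, although it is a subset of \<open>X\<close>.\<close>
lemma cball_subset_domain:
  assumes x: "x \<in> X" and r: "r * \<l> (2 * norm (grad f x)) \<le> norm (grad f x)"
  shows "cball x r \<subseteq> X"
proof (rule ccontr)
  define u where "u = norm (grad f x)"
  have M: "\<l> (2 * u) > 0" by (simp add: u_def l_pos)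
  assume "\<not> cball x r \<subseteq> X"
  then have "cball x r - X \<noteq> {}" by blast
  moreover have "closed (cball x r - X)" using open_X by (intro closed_Diff) auto
  ultimately obtain z where z: "z \<in> cball x r - X" and
    near: "\<And>w. w \<in> cball x r - X \<Longrightarrow> dist x z \<le> dist x w"
    using distance_attains_inf by blast
  have sub: "ball x (dist x z) \<subseteq> X"
  proof
    fix w assume "w \<in> ball x (dist x z)"
    then show "w \<in> X" using near[of w] z by (cases "w \<in> X") auto
  qed
  have r0: "dist x z * \<l> (2 * u) \<le> u"
  proof -
    have "dist x z * \<l> (2 * u) \<le> r * \<l> (2 * u)" using z M by (intro mult_right_mono) auto
    then show ?thesis using r by (simp add: u_def)
  qed
  define a where "a = f x + r * u + \<l> (2 * u) / 2 * r\<^sup>2"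
  have "ball x (dist x z) \<subseteq> {w \<in> X. f w \<le> a}"
  proof
    fix w assume w: "w \<in> ball x (dist x z)"
    then have nr: "norm (w - x) \<le> r" using z by (auto simp: dist_norm norm_minus_commute)
    have "(w - x) \<bullet> grad f x \<le> r * u"
    proof -
      have "norm (w - x) * u \<le> r * u" using nr by (intro mult_right_mono) (auto simp: u_def)
      then show ?thesis using norm_cauchy_schwarz[of "w - x" "grad f x"] by (simp add: u_def)
    qed
    moreover have "\<l> (2 * u) / 2 * (norm (w - x))\<^sup>2 \<le> \<l> (2 * u) / 2 * r\<^sup>2"
      using nr M by (intro mult_left_mono power_mono) auto
    ultimately have "f w \<le> a"
      using quadratic_bound_on_ball[OF x sub r0[unfolded u_def] w] by (simp add: a_def u_def)
    then show "w \<in> {w \<in> X. f w \<le> a}" using w sub by auto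
  qed
  then have "closure (ball x (dist x z)) \<subseteq> {w \<in> X. f w \<le> a}"
    by (rule closure_minimal) (rule closed_sublevel)
  moreover have "x \<noteq> z" using x z by auto
  ultimately show False using z by auto
qed

text \<open>The radius \<open>u / \<l> (2 * u)\<close> itself is reached here by continuity. This boundary case is needed:
  a gradient step of size exactly \<open>1 / \<l> (2 * u)\<close> has this length.\<close>
lemma quadratic_bound:
  assumes x: "x \<in> X"
    and y: "norm (y - x) * \<l> (2 * norm (grad f x)) \<le> norm (grad f x)"
  shows "y \<in> X"
    and "f y \<le> f x + (y - x) \<bullet> grad f x + \<l> (2 * norm (grad f x)) / 2 * (norm (y - x))\<^sup>2"
proof -
  define \<rho> where "\<rho> = norm (y - x)"
  have sub: "cball x \<rho> \<subseteq> X" using cball_subset_domain[OF x y] by (simp add: \<rho>_def)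
  show yX: "y \<in> X" using sub by (rule subsetD) (simp add: \<rho>_def dist_norm norm_minus_commute)
  define h where "h z = f z - (f x + (z - x) \<bullet> grad f x
      + \<l> (2 * norm (grad f x)) / 2 * (norm (z - x))\<^sup>2)" for z
  show "f y \<le> f x + (y - x) \<bullet> grad f x + \<l> (2 * norm (grad f x)) / 2 * (norm (y - x))\<^sup>2"
  proof (cases "y = x")
    case False
    then have "\<rho> > 0" by (simp add: \<rho>_def)
    have "h y \<le> 0"
    proof (rule continuous_le_on_closure[of "ball x \<rho>"])
      have "continuous_on X h"
        unfolding h_def using differentiable_imp_continuous_on[OF differentiable_f]
        by (intro continuous_intros)
      then show "continuous_on (closure (ball x \<rho>)) h"
        using sub \<open>\<rho> > 0\<close> by (auto intro: continuous_on_subset)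
      show "y \<in> closure (ball x \<rho>)"
        using \<open>\<rho> > 0\<close> by (simp add: \<rho>_def dist_norm norm_minus_commute)
      show "h z \<le> 0" if "z \<in> ball x \<rho>" for z
        using quadratic_bound_on_ball[OF x _ y[folded \<rho>_def] that]
          order_trans[OF ball_subset_cball sub] by (simp add: h_def)
    qed
    then show ?thesis by (simp add: h_def)
  qed simp
qed

section \<open>Gradient descent\<close>

text \<open>The step has length \<open>\<eta> * u\<close>, so the first-order term of the quadratic bound is \<open>- \<eta> * u\<^sup>2\<close>, and
  \<open>\<eta> * \<l> (2 * u) \<le> 1\<close> keeps the second-order term to at most half of its size.\<close>
lemma gradient_step:
  assumes x: "x \<in> X" and \<eta>: "0 \<le> \<eta>" "\<eta> * \<l> (2 * norm (grad f x)) \<le> 1"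
  shows "x - \<eta> *\<^sub>R grad f x \<in> X"
    and "f (x - \<eta> *\<^sub>R grad f x) \<le> f x - \<eta> / 2 * (norm (grad f x))\<^sup>2"
proof -
  define u where "u = norm (grad f x)"
  define y where "y = x - \<eta> *\<^sub>R grad f x"
  have n: "norm (y - x) = \<eta> * u" using \<eta> by (simp add: y_def u_def)
  have "norm (y - x) * \<l> (2 * u) = (\<eta> * \<l> (2 * u)) * u" by (simp add: n)
  also have "\<dots> \<le> u" using \<eta> by (intro mult_left_le_one_le) (auto simp: u_def l_pos less_imp_le)
  finally have c: "norm (y - x) * \<l> (2 * norm (grad f x)) \<le> norm (grad f x)" by (simp add: u_def)
  from quadratic_bound(1)[OF x c] show "x - \<eta> *\<^sub>R grad f x \<in> X" by (simp add: y_def)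
  have "(\<eta> * \<l> (2 * u)) * (\<eta> * u\<^sup>2) \<le> \<eta> * u\<^sup>2"
    using \<eta> by (intro mult_left_le_one_le) (auto simp: u_def l_pos less_imp_le)
  moreover have "(y - x) \<bullet> grad f x = - \<eta> * u\<^sup>2"
    by (simp add: y_def u_def power2_norm_eq_inner)
  ultimately show "f (x - \<eta> *\<^sub>R grad f x) \<le> f x - \<eta> / 2 * (norm (grad f x))\<^sup>2"
    using quadratic_bound(2)[OF x c]
    by (simp add: n y_def[symmetric] u_def[symmetric] power_mult_distrib power2_eq_square algebra_simps)
qed

text \<open>The longest admissible step, of size \<open>1 / \<l> (2 * u)\<close>, lowers \<open>f\<close> by at least
  \<open>u\<^sup>2 / (2 * \<l> (2 * u))\<close>, and it ends in \<open>X\<close>, where \<open>m\<close> is a lower bound.\<close>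
lemma grad_square_le:
  assumes x: "x \<in> X" and lower: "\<And>z. z \<in> X \<Longrightarrow> m \<le> f z"
  shows "(norm (grad f x))\<^sup>2 \<le> 2 * \<l> (2 * norm (grad f x)) * (f x - m)"
proof -
  have M: "0 < \<l> (2 * norm (grad f x))" by (simp add: l_pos)
  then have "m \<le> f x - 1 / \<l> (2 * norm (grad f x)) / 2 * (norm (grad f x))\<^sup>2"
    using gradient_step[OF x, of "1 / \<l> (2 * norm (grad f x))"] lower by fastforce
  with M show ?thesis by (simp add: field_simps)
qed

end

text \<open>With \<open>v = 2 * u\<close> large, \<open>\<l> v < \<epsilon> * v\<^sup>2\<close> gives \<open>2 * \<l> (2 * u) * \<Delta> \<le> 8 * \<epsilon> * \<Delta> * u\<^sup>2\<close>. The choice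
  \<open>\<epsilon> = 1 / (8 * \<Delta> + 1)\<close> makes the last coefficient less than \<open>1\<close>, so that no large \<open>u\<close> belongs to the
  set; the summand \<open>1\<close> covers \<open>\<Delta> = 0\<close>.\<close>
lemma sub_quadratic_bdd_above:
  assumes "sub_quadratic \<l>" "0 \<le> \<Delta>"
  shows "bdd_above {u. 0 \<le> u \<and> u\<^sup>2 \<le> 2 * \<l> (2 * u) * \<Delta>}"
proof -
  define \<epsilon> where "\<epsilon> = 1 / (8 * \<Delta> + 1)"
  have "\<epsilon> > 0" using assms(2) by (simp add: \<epsilon>_def)
  with assms(1) have "\<forall>\<^sub>F v in at_top. \<l> v / v\<^sup>2 < \<epsilon>"
    unfolding sub_quadratic_def by (rule order_tendstoD)
  then obtain B where B: "\<And>v. v \<ge> B \<Longrightarrow> \<l> v / v\<^sup>2 < \<epsilon>"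
    unfolding eventually_at_top_linorder by blast
  have "u \<le> max 1 B" if u: "0 \<le> u" "u\<^sup>2 \<le> 2 * \<l> (2 * u) * \<Delta>" for u
  proof (rule ccontr)
    assume "\<not> u \<le> max 1 B"
    then have u1: "u > 1" "2 * u \<ge> B" by auto
    then have "\<l> (2 * u) < \<epsilon> * (2 * u)\<^sup>2"
      using B[of "2 * u"] by (simp add: pos_divide_less_eq)
    then have "2 * \<l> (2 * u) * \<Delta> \<le> 2 * (\<epsilon> * (2 * u)\<^sup>2) * \<Delta>"
      using assms(2) by (intro mult_right_mono) auto
    also have "\<dots> = (8 * \<Delta> * \<epsilon>) * u\<^sup>2" by (simp add: power2_eq_square)
    also have "\<dots> < 1 * u\<^sup>2"
      using u1 assms(2) by (intro mult_strict_right_mono) (auto simp: \<epsilon>_def)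
    finally show False using u by simp
  qed
  then show ?thesis by (intro bdd_aboveI) auto
qed

theorem theorem5p2:
  fixes X :: "'a::euclidean_space set"
    and f :: "'a \<Rightarrow> real"
    and \<l> :: "real \<Rightarrow> real"
    and x0 :: 'a
    and fstar G L \<eta> :: real
  assumes "open X"
    and "f differentiable_on X"
    and "\<And>a. closed {x \<in> X. f x \<le> a}"
    and "bdd_below (f ` X)"
    and "fstar = (INF x\<in>X. f x)"
    and "mono_on {0..} \<l>"
    and "continuous_on {0..} \<l>"
    and "\<And>u. 0 \<le> u \<Longrightarrow> 0 < \<l> u"
    and "sub_quadratic \<l>"
    and "ell_smooth_on X \<l> f"
    and "x0 \<in> X"
    and "G = Sup {u. 0 \<le> u \<and> u\<^sup>2 \<le> 2 * \<l> (2 * u) * (f x0 - fstar)}"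
    and "L = \<l> (2 * G)"
    and "0 < \<eta>"
    and "\<eta> \<le> 1 / L"
  shows "(\<forall>t. gd_iterate f \<eta> x0 t \<in> X \<and> norm (grad f (gd_iterate f \<eta> x0 t)) \<le> G) \<and>
         (\<forall>T\<ge>1. 1 / real T * (\<Sum>t<T. (norm (grad f (gd_iterate f \<eta> x0 t)))\<^sup>2)
                  \<le> 2 * (f x0 - fstar) / (\<eta> * real T))"
proof -
  interpret ell_smooth_closed X f \<l>
    by unfold_locales (use assms in auto)
  let ?x = "gd_iterate f \<eta> x0"
  let ?S = "{u. 0 \<le> u \<and> u\<^sup>2 \<le> 2 * \<l> (2 * u) * (f x0 - fstar)}"
  have lower: "fstar \<le> f z" if "z \<in> X" for z
    using assms(4,5) that by (auto intro: cINF_lower)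
  have bdd: "bdd_above ?S"
    using lower[OF assms(11)] by (intro sub_quadratic_bdd_above assms(9)) auto
  have G_bound: "norm (grad f x) \<le> G" if x: "x \<in> X" "f x \<le> f x0" for x
  proof -
    have "2 * \<l> (2 * norm (grad f x)) * (f x - fstar) \<le> 2 * \<l> (2 * norm (grad f x)) * (f x0 - fstar)"
      using x(2) by (intro mult_left_mono) (auto simp: l_pos less_imp_le)
    with grad_square_le[OF x(1) lower] have "norm (grad f x) \<in> ?S" by force
    then show ?thesis unfolding assms(12) using bdd by (rule cSup_upper)
  qed
  have step: "x - \<eta> *\<^sub>R grad f x \<in> X"
      "f (x - \<eta> *\<^sub>R grad f x) \<le> f x - \<eta> / 2 * (norm (grad f x))\<^sup>2"
    if x: "x \<in> X" "f x \<le> f x0" for x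
  proof -
    have G0: "0 \<le> G" using G_bound[OF x] norm_ge_zero order_trans by blast
    have "\<eta> * \<l> (2 * norm (grad f x)) \<le> \<eta> * L"
      unfolding assms(13) using assms(14) G_bound[OF x] G0
      by (intro mult_left_mono mono_onD[OF mono_l]) auto
    also have "\<dots> \<le> 1"
      using assms(15) l_pos[of "2 * G"] G0 by (simp add: assms(13) pos_le_divide_eq)
    finally have "\<eta> * \<l> (2 * norm (grad f x)) \<le> 1" .
    with gradient_step[OF x(1), of \<eta>] assms(14)
    show "x - \<eta> *\<^sub>R grad f x \<in> X"
      "f (x - \<eta> *\<^sub>R grad f x) \<le> f x - \<eta> / 2 * (norm (grad f x))\<^sup>2" by auto
  qed
  have nonneg: "0 \<le> \<eta> / 2 * (\<Sum>t<T. (norm (grad f (?x t)))\<^sup>2)" for T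
    using assms(14) by (intro mult_nonneg_nonneg sum_nonneg) auto
  have inv: "?x T \<in> X \<and> f (?x T) \<le> f x0 - \<eta> / 2 * (\<Sum>t<T. (norm (grad f (?x t)))\<^sup>2)" for T
  proof (induction T)
    case (Suc T)
    have "f (?x T) \<le> f x0" using Suc nonneg[of T] by linarith
    with step[of "?x T"] Suc show ?case by (auto simp: algebra_simps)
  qed (use assms(11) in simp)
  have desc: "f (?x T) \<le> f x0" for T
    using inv[of T] nonneg[of T] by linarith
  have "1 / real T * (\<Sum>t<T. (norm (grad f (?x t)))\<^sup>2) \<le> 2 * (f x0 - fstar) / (\<eta> * real T)"
    if "T \<ge> 1" for T
  proof -
    have "\<eta> / 2 * (\<Sum>t<T. (norm (grad f (?x t)))\<^sup>2) \<le> f x0 - fstar"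
      using inv[of T] lower[of "?x T"] by linarith
    then show ?thesis using assms(14) that by (simp add: field_simps)
  qed
  with inv desc G_bound show ?thesis by blast
qed

end
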